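(* Let $(m(r),P(r))$, $0<r<r_+$, be a monotone-short solution of the Tolman-Oppenheimer-Volkoff-de Sitter equation. Then the interior metric $$ds^2=\kappa_+e^{-2u(r)/c^2}c^2dt^2-\frac{1}{\kappa(r,m(r))}dr^2-r^2(d\theta^2+\sin^2\theta\,d\phi^2)\qquad(r<r_+)$$ extends to the exterior Schwarzschild-de Sitter metric $$ds^2=\kappa(r,m_+)c^2dt^2-\frac1{\kappa(r,m_+)}dr^2-r^2(d\theta^2+\sin^2\theta\,d\phi^2)\qquad(r_+\le r<r_E)$$ on the vacuum region with twice continuous differentiability. That is, the patched coefficients $$g_{00}(r)=\begin{cases}\kappa_+e^{-2u(r)/c^2}&(0<r<r_+)\\ 1-\frac{2Gm_+}{c^2r}-\frac{\Lambda}{3}r^2&(r_+\le r<r_E)\end{cases},\qquad g_{11}(r)=-\Big(1-\frac{2G\tilde m(r)}{c^2r}-\frac{\Lambda}{3}r^2\Big)^{-1}\quad(0<r<r_E),$$ where $\tilde m(r)=m(r)$ for $0<r<r_+$ and $\tilde m(r)=m_+$ for $r_+\le r<r_E$, are twice continuously differentiable functions of $r$ on $(0,r_E)$, in particular across $r=r_+$.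
   Context: Constants: $c>0$, $G>0$, $\Lambda>0$. Standing assumption on the pressure: $P$ is a given function of the density $\rho>0$ with $P>0$ and $0<dP/d\rho<c^2$ for $\rho>0$, and $P\to0$ as $\rho\to+0$; moreover $P=A\rho^{\gamma}\Omega(A\rho^{\gamma-1}/c^2)$ with positive constants $A,\gamma$, $1<\gamma<2$, and $\Omega$ real analytic on a neighborhood of $[0,+\infty)$ with $\Omega(0)=1$. Since $P$ is strictly increasing in $\rho$, $\rho$ is regarded as a function of $P$. Notation: $\kappa(r,m):=1-\frac{2Gm}{c^2r}-\frac{\Lambda}{3}r^2$ and $Q(r,m,P):=G\big(m+\frac{4\pi r^3}{c^2}P\big)-\frac{c^2\Lambda}{3}r^3$. The Tolman-Oppenheimer-Volkoff-de Sitter equation is the system $$\frac{dm}{dr}=4\pi r^2\rho,\qquad \frac{dP}{dr}=-(\rho+P/c^2)\frac{Q(r,m,P)}{r^2\kappa(r,m)}$$ considered on the domain $\mathcal D=\{(r,m,P): 0<r,\ |m|<+\infty,\ 0<\rho,\ 0<\kappa(r,m)\}$. Monotone-short: a solution $(m(r),P(r))$, $0<r<r_+$, is monotone-short if $r_+<\infty$, $dP/dr<0$ for $0<r<r_+$, $P\to0$ as $r\to r_+$, and $\kappa_+>0$, $Q_+>0$, where, with $m_+:=\lim_{r\to r_+-0}m(r)$, $$\kappa_+:=\lim_{r\to r_+-0}\kappa(r,m(r))=1-\frac{2Gm_+}{c^2r_+}-\frac{\Lambda}{3}r_+^2,\qquad Q_+:=\lim_{r\to r_+-0}Q(r,m(r),P(r))=Gm_+-\frac{c^2\Lambda}{3}r_+^3.$$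 The variable $u$: $u:=\int_0^{\rho}\frac{dP}{\rho+P/c^2}=\int_0^{\rho}\frac{P'(\rho')\,d\rho'}{\rho'+P(\rho')/c^2}$, and $u(r)$ is its value at the density $\rho(r)$ of the solution. The number $r_E$: for a monotone-short solution, $\kappa_+=\kappa(r_+,m_+)>0$ and there are $0<r_I<r_+<r_E<+\infty$ such that, for $r>0$, $\kappa(r,m_+)>0$ if and only if $r_I<r<r_E$ ($r_I$ and $r_E$ are the black hole horizon and the cosmological horizon). *)

theory Defs
  imports "HOL-Analysis.Analysis"
begin

definition real_analytic_on :: "(real \<Rightarrow> real) \<Rightarrow> real set \<Rightarrow> bool" where
  "real_analytic_on f S \<longleftrightarrow> (\<forall>x\<in>S. \<exists>F. (\<lambda>h. f (x + h)) has_fps_expansion F)"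

text \<open>For open \<open>S\<close> this is the class of twice continuously differentiable functions on \<open>S\<close>.\<close>

definition C2_differentiable_on :: "(real \<Rightarrow> real) \<Rightarrow> real set \<Rightarrow> bool" where
  "C2_differentiable_on f S \<longleftrightarrow>
     (\<exists>f'. (\<forall>x\<in>S. (f has_real_derivative f' x) (at x)) \<and> f' C1_differentiable_on S)"

text \<open>The pressure is a function \<open>P\<close> of the density; only its values at positive densities matter.\<close>

definition pressure_law ::
    "real \<Rightarrow> real \<Rightarrow> real \<Rightarrow> (real \<Rightarrow> real) \<Rightarrow> (real \<Rightarrow> real) \<Rightarrow> bool" where
  "pressure_law c A \<gamma> \<Omega> P \<longleftrightarrow>
     (\<forall>\<rho>>0. 0 < P \<rho>) \<and>
     (\<forall>\<rho>>0. P field_differentiable (at \<rho>) \<and> 0 < deriv P \<rho> \<and> deriv P \<rho> < c\<^sup>2) \<and>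
     (P \<longlongrightarrow> 0) (at_right 0) \<and>
     0 < A \<and> 1 < \<gamma> \<and> \<gamma> < 2 \<and>
     (\<exists>U. open U \<and> {0..} \<subseteq> U \<and> real_analytic_on \<Omega> U) \<and> \<Omega> 0 = 1 \<and>
     (\<forall>\<rho>>0. P \<rho> = A * \<rho> powr \<gamma> * \<Omega> (A * \<rho> powr (\<gamma> - 1) / c\<^sup>2))"

text \<open>The density as a function of the pressure; meaningful for \<open>p \<in> P ` {0<..}\<close>.\<close>

definition density :: "(real \<Rightarrow> real) \<Rightarrow> real \<Rightarrow> real" where
  "density P p = the_inv_into {0<..} P p"

definition kappa :: "real \<Rightarrow> real \<Rightarrow> real \<Rightarrow> real \<Rightarrow> real \<Rightarrow> real" where
  "kappa c G \<Lambda> r m = 1 - 2 * G * m / (c\<^sup>2 * r) - \<Lambda> / 3 * r\<^sup>2"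

definition Q_fun :: "real \<Rightarrow> real \<Rightarrow> real \<Rightarrow> real \<Rightarrow> real \<Rightarrow> real \<Rightarrow> real" where
  "Q_fun c G \<Lambda> r m p = G * (m + 4 * pi * r ^ 3 / c\<^sup>2 * p) - c\<^sup>2 * \<Lambda> / 3 * r ^ 3"

text \<open>The condition \<open>p \<in> P ` {0<..}\<close> says that \<open>p\<close> is the pressure at some positive density.\<close>

definition tov_domain ::
    "real \<Rightarrow> real \<Rightarrow> real \<Rightarrow> (real \<Rightarrow> real) \<Rightarrow> (real \<times> real \<times> real) set" where
  "tov_domain c G \<Lambda> P = {(r, m, p). 0 < r \<and> p \<in> P ` {0<..} \<and> 0 < kappa c G \<Lambda> r m}"

definition tov_solution ::
    "real \<Rightarrow> real \<Rightarrow> real \<Rightarrow> (real \<Rightarrow> real) \<Rightarrow> real \<Rightarrow> (real \<Rightarrow> real) \<Rightarrow> (real \<Rightarrow> real) \<Rightarrow> bool" where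
  "tov_solution c G \<Lambda> P rp m p \<longleftrightarrow>
     (\<forall>r\<in>{0<..<rp}.
        (r, m r, p r) \<in> tov_domain c G \<Lambda> P \<and>
        (m has_real_derivative 4 * pi * r\<^sup>2 * density P (p r)) (at r) \<and>
        (p has_real_derivative
           - (density P (p r) + p r / c\<^sup>2) * (Q_fun c G \<Lambda> r (m r) (p r) / (r\<^sup>2 * kappa c G \<Lambda> r (m r))))
          (at r))"

text \<open>
  Boundary values at \<open>r\<^sub>+\<close>. For the solutions in \<open>monotone_short\<close> below these limits exist:
  \<open>m\<close> is increasing, and bounded near \<open>r\<^sub>+\<close> because the density is.
\<close>

definition m_plus :: "real \<Rightarrow> (real \<Rightarrow> real) \<Rightarrow> real" where
  "m_plus rp m = Lim (at_left rp) m"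

definition kappa_plus :: "real \<Rightarrow> real \<Rightarrow> real \<Rightarrow> real \<Rightarrow> (real \<Rightarrow> real) \<Rightarrow> real" where
  "kappa_plus c G \<Lambda> rp m = Lim (at_left rp) (\<lambda>r. kappa c G \<Lambda> r (m r))"

definition Q_plus ::
    "real \<Rightarrow> real \<Rightarrow> real \<Rightarrow> real \<Rightarrow> (real \<Rightarrow> real) \<Rightarrow> (real \<Rightarrow> real) \<Rightarrow> real" where
  "Q_plus c G \<Lambda> rp m p = Lim (at_left rp) (\<lambda>r. Q_fun c G \<Lambda> r (m r) (p r))"

definition monotone_short ::
    "real \<Rightarrow> real \<Rightarrow> real \<Rightarrow> (real \<Rightarrow> real) \<Rightarrow> real \<Rightarrow> (real \<Rightarrow> real) \<Rightarrow> (real \<Rightarrow> real) \<Rightarrow> bool" where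
  "monotone_short c G \<Lambda> P rp m p \<longleftrightarrow>
     0 < rp \<and> tov_solution c G \<Lambda> P rp m p \<and>
     (\<forall>r\<in>{0<..<rp}. deriv p r < 0) \<and>
     (p \<longlongrightarrow> 0) (at_left rp) \<and>
     0 < kappa_plus c G \<Lambda> rp m \<and> 0 < Q_plus c G \<Lambda> rp m p"

text \<open>
  The integrand behaves like a multiple of \<open>s powr (\<gamma> - 2)\<close> at \<open>0\<close>, hence is integrable
  since \<open>\<gamma> > 1\<close>; its value at the endpoint \<open>0\<close> is irrelevant.
\<close>

definition u_of_density :: "real \<Rightarrow> (real \<Rightarrow> real) \<Rightarrow> real \<Rightarrow> real" where
  "u_of_density c P \<rho> = integral {0..\<rho>} (\<lambda>s. deriv P s / (s + P s / c\<^sup>2))"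

definition u_sol :: "real \<Rightarrow> (real \<Rightarrow> real) \<Rightarrow> (real \<Rightarrow> real) \<Rightarrow> real \<Rightarrow> real" where
  "u_sol c P p r = u_of_density c P (density P (p r))"

text \<open>\<open>rI\<close> is the black hole horizon and \<open>rE\<close> the cosmological horizon of the exterior metric
  of mass \<open>M\<close>.\<close>

definition horizons ::
    "real \<Rightarrow> real \<Rightarrow> real \<Rightarrow> real \<Rightarrow> real \<Rightarrow> real \<Rightarrow> real \<Rightarrow> bool" where
  "horizons c G \<Lambda> rp M rI rE \<longleftrightarrow>
     0 < rI \<and> rI < rp \<and> rp < rE \<and> (\<forall>r>0. 0 < kappa c G \<Lambda> r M \<longleftrightarrow> rI < r \<and> r < rE)"

text \<open>
  The quadratic form \<open>a c\<^sup>2 dt\<^sup>2 + b dr\<^sup>2 - r\<^sup>2 (d\<theta>\<^sup>2 + sin\<^sup>2 \<theta> d\<phi>\<^sup>2)\<close> at the point with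
  radius \<open>r\<close> and polar angle \<open>\<theta>\<close>, on the tangent vector with components
  \<open>(dt, dr, d\<theta>, d\<phi>)\<close>.
\<close>

definition spherical_metric ::
    "real \<Rightarrow> real \<Rightarrow> real \<Rightarrow> real \<Rightarrow> real \<Rightarrow> real \<times> real \<times> real \<times> real \<Rightarrow> real" where
  "spherical_metric c a b r \<theta> =
     (\<lambda>(dt, dr, d\<theta>, d\<phi>).
        a * c\<^sup>2 * dt\<^sup>2 + b * dr\<^sup>2 - r\<^sup>2 * (d\<theta>\<^sup>2 + (sin \<theta>)\<^sup>2 * d\<phi>\<^sup>2))"

definition interior_metric ::
    "real \<Rightarrow> real \<Rightarrow> real \<Rightarrow> (real \<Rightarrow> real) \<Rightarrow> real \<Rightarrow> (real \<Rightarrow> real) \<Rightarrow> (real \<Rightarrow> real) \<Rightarrow>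
     real \<Rightarrow> real \<Rightarrow> real \<times> real \<times> real \<times> real \<Rightarrow> real" where
  "interior_metric c G \<Lambda> P rp m p r =
     spherical_metric c (kappa_plus c G \<Lambda> rp m * exp (- 2 * u_sol c P p r / c\<^sup>2))
       (- 1 / kappa c G \<Lambda> r (m r)) r"

definition exterior_metric ::
    "real \<Rightarrow> real \<Rightarrow> real \<Rightarrow> real \<Rightarrow>
     real \<Rightarrow> real \<Rightarrow> real \<times> real \<times> real \<times> real \<Rightarrow> real" where
  "exterior_metric c G \<Lambda> M r =
     spherical_metric c (kappa c G \<Lambda> r M) (- 1 / kappa c G \<Lambda> r M) r"

definition g00 ::
    "real \<Rightarrow> real \<Rightarrow> real \<Rightarrow> (real \<Rightarrow> real) \<Rightarrow> real \<Rightarrow> (real \<Rightarrow> real) \<Rightarrow> (real \<Rightarrow> real) \<Rightarrow>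
     real \<Rightarrow> real" where
  "g00 c G \<Lambda> P rp m p r =
     (if r < rp then kappa_plus c G \<Lambda> rp m * exp (- 2 * u_sol c P p r / c\<^sup>2)
      else 1 - 2 * G * m_plus rp m / (c\<^sup>2 * r) - \<Lambda> / 3 * r\<^sup>2)"

definition m_tilde :: "real \<Rightarrow> (real \<Rightarrow> real) \<Rightarrow> real \<Rightarrow> real" where
  "m_tilde rp m r = (if r < rp then m r else m_plus rp m)"

definition g11 :: "real \<Rightarrow> real \<Rightarrow> real \<Rightarrow> real \<Rightarrow> (real \<Rightarrow> real) \<Rightarrow> real \<Rightarrow> real" where
  "g11 c G \<Lambda> rp m r =
     - inverse (1 - 2 * G * m_tilde rp m r / (c\<^sup>2 * r) - \<Lambda> / 3 * r\<^sup>2)"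

end

theory Submission
  imports Defs
begin

text \<open>
  Along the solution \<open>du/dr = -Q/(r\<^sup>2 \<kappa>)\<close>, and the exterior coefficient satisfies
  \<open>d\<kappa>/dr = 2 Q / (c\<^sup>2 r\<^sup>2)\<close> with vanishing pressure. Hence both branches of \<open>g\<^sub>0\<^sub>0\<close> solve the
  same linear equation \<open>g\<^sub>0\<^sub>0' = g\<^sub>0\<^sub>0 \<cdot> (2/c\<^sup>2) Q/(r\<^sup>2 \<kappa>)\<close>, where mass, pressure and density are
  continued past \<open>r\<^sub>+\<close> by \<open>m\<^sub>+\<close>, \<open>0\<close> and \<open>0\<close>. It therefore suffices that the continued mass,
  pressure and density are \<open>C\<^sup>1\<close>. The delicate one is the density: its slope is
  \<open>-((\<rho> + P/c\<^sup>2) / P'(\<rho>)) Q/(r\<^sup>2 \<kappa>)\<close>, and \<open>(\<rho> + P/c\<^sup>2) / P'(\<rho>)\<close> is of order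
  \<open>\<rho> powr (2 - \<gamma>)\<close>, which tends to \<open>0\<close> as \<open>\<gamma> < 2\<close>.
\<close>

section \<open>Piecewise differentiable functions\<close>

text \<open>A local power series may be differentiated termwise: its formal derivative expands
  \<open>deriv f\<close> around \<open>x\<close>, and a function with such an expansion is
  continuous at the centre. Applied to \<open>\<Omega>\<close>, this controls \<open>deriv P\<close>
  down to zero density.\<close>

lemma real_analytic_on_has_derivative:
  assumes "real_analytic_on f S" "x \<in> S"
  shows "(f has_real_derivative deriv f x) (at x)" "isCont (deriv f) x"
proof -
  define g where "g = (\<lambda>h. f (x + h))"
  obtain F where F: "g has_fps_expansion F"
    using assms unfolding real_analytic_on_def g_def by blast
  then have "0 < fps_conv_radius F" and ev: "\<forall>\<^sub>F z in nhds 0. eval_fps F z = g z"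
    by (auto simp: has_fps_expansion_def)
  then have "(eval_fps F has_real_derivative eval_fps (fps_deriv F) 0) (at 0)"
    by (intro has_field_derivative_eval_fps) (auto simp: zero_ereal_def)
  then have "(g has_real_derivative eval_fps (fps_deriv F) 0) (at 0)"
    using DERIV_cong_ev[OF refl ev refl] by blast
  then have "(f has_real_derivative eval_fps (fps_deriv F) 0) (at x)"
    using DERIV_shift[of f _ 0 x] by (simp add: g_def add.commute)
  then show "(f has_real_derivative deriv f x) (at x)"
    using DERIV_imp_deriv by fastforce
  have "deriv g = (\<lambda>h. deriv f (h + x))"
    by (simp add: deriv_def g_def DERIV_shift add.commute fun_eq_iff)
  then have "isCont (\<lambda>h. deriv f (h + x)) 0"
    using has_fps_expansion_imp_continuous[OF has_fps_expansion_deriv[OF F], of UNIV] by simp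
  then show "isCont (deriv f) x"
    by (simp add: isCont_def add.commute[of _ x] LIM_offset_zero_cancel)
qed

text \<open>The fundamental theorem of calculus tolerates the exceptional point \<open>d\<close>, so
  near \<open>x\<close> the function \<open>F\<close> is a constant plus the integral of
  \<open>F'\<close>. Since \<open>F'\<close> is continuous, that integral is differentiable
  everywhere, including at \<open>d\<close>. This avoids computing one-sided derivatives at the
  surface of the star.\<close>

lemma DERIV_interior_point:
  fixes F F' :: "real \<Rightarrow> real"
  assumes d: "d \<in> {a<..<b}"
    and F: "continuous_on {a<..<b} F" and F': "continuous_on {a<..<b} F'"
    and D: "\<And>x. x \<in> {a<..<b} \<Longrightarrow> x \<noteq> d \<Longrightarrow> (F has_real_derivative F' x) (at x)"
    and x: "x \<in> {a<..<b}"
  shows "(F has_real_derivative F' x) (at x)"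
proof -
  obtain \<alpha> \<beta> where ab: "a < \<alpha>" "\<alpha> < x" "x < \<beta>" "\<beta> < b"
    using x dense by (metis greaterThanLessThan_iff)
  have sub: "{\<alpha>..\<beta>} \<subseteq> {a<..<b}" using ab by auto
  have eq: "F y = F \<alpha> + integral {\<alpha>..y} F'" if "y \<in> {\<alpha>..\<beta>}" for y
  proof -
    have "(F' has_integral (F y - F \<alpha>)) {\<alpha>..y}"
    proof (rule fundamental_theorem_of_calculus_interior_strong[of "{d}"])
      show "continuous_on {\<alpha>..y} F"
        by (rule continuous_on_subset[OF F]) (use that ab in auto)
    qed (use that ab D in \<open>auto simp: has_real_derivative_iff_has_vector_derivative[symmetric]\<close>)
    then show ?thesis by (simp add: integral_unique)
  qed
  have "((\<lambda>y. integral {\<alpha>..y} F') has_real_derivative F' x) (at x within {\<alpha>..\<beta>})"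
    by (rule integral_has_real_derivative) (use continuous_on_subset[OF F' sub] ab in auto)
  then have "((\<lambda>y. F \<alpha> + integral {\<alpha>..y} F') has_real_derivative F' x) (at x within {\<alpha>..\<beta>})"
    by (auto intro!: derivative_eq_intros)
  then have "(F has_real_derivative F' x) (at x within {\<alpha>..\<beta>})"
    using eq[symmetric] ab by (auto elim!: has_field_derivative_transform_within[where d = 1])
  moreover have "at x within {\<alpha>..\<beta>} = at x"
    by (rule at_within_interior) (use ab in auto)
  ultimately show ?thesis by simp
qed

lemma continuous_on_piecewise:
  fixes f g :: "real \<Rightarrow> real"
  assumes f: "continuous_on {a<..<d} f" and g: "continuous_on {d..<b} g"
    and lim: "(f \<longlongrightarrow> g d) (at_left d)" and d: "a < d" "d < b"
  shows "continuous_on {a<..<b} (\<lambda>x. if x < d then f x else g x)" (is "continuous_on _ ?h")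
proof -
  have un: "{a<..d} \<union> {d..<b} = {a<..<b}" using d by auto
  \<comment> \<open>Both relatively closed pieces contain \<open>d\<close>, so the left branch is
    first redefined there as \<open>g d\<close>; the value \<open>f d\<close> itself is
    arbitrary.\<close>
  have "continuous_on ({a<..d} \<union> {d..<b}) (\<lambda>x. if x \<le> d then (if x < d then f x else g d) else g x)"
  proof (rule continuous_on_cases_local)
    show "continuous_on {a<..d} (\<lambda>x. if x < d then f x else g d)"
    proof (clarsimp simp: continuous_on_eq_continuous_within)
      fix x assume x: "a < x" "x \<le> d"
      show "continuous (at x within {a<..d}) (\<lambda>x. if x < d then f x else g d)"
      proof (cases "x = d")
        case True
        have "((\<lambda>x. if x < d then f x else g d) \<longlongrightarrow> g d) (at_left d)"
          using lim by (rule Lim_transform_eventually) (auto simp: eventually_at_filter)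
        moreover have "at d within {a<..d} = at_left d"
          by (rule at_within_nhd[of _ "{a<..}"]) (use \<open>a < d\<close> in auto)
        ultimately show ?thesis using True by (simp add: continuous_within)
      next
        case False
        then have x': "x \<in> {a<..<d}" using x by auto
        then have "isCont f x" using f continuous_on_eq_continuous_at open_greaterThanLessThan by blast
        moreover have "\<forall>\<^sub>F y in nhds x. f y = (if y < d then f y else g d)"
          by (rule eventually_mono[OF eventually_nhds_in_open[OF open_greaterThanLessThan x']]) auto
        ultimately have "isCont (\<lambda>x. if x < d then f x else g d) x"
          using isCont_cong[of f _ x] by simp
        then show ?thesis by (rule continuous_at_imp_continuous_at_within)
      qed
    qed
    have "closedin (top_of_set {a<..<b}) ({a<..<b} \<inter> {..d})"
      "closedin (top_of_set {a<..<b}) ({a<..<b} \<inter> {d..})"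
      by (simp_all add: closedin_closed_Int)
    moreover have "{a<..<b} \<inter> {..d} = {a<..d}" "{a<..<b} \<inter> {d..} = {d..<b}"
      using d by auto
    ultimately show "closedin (top_of_set ({a<..d} \<union> {d..<b})) {a<..d}"
      "closedin (top_of_set ({a<..d} \<union> {d..<b})) {d..<b}"
      by (simp_all add: un)
  qed (use g d in auto)
  moreover note un
  moreover have "(\<lambda>x. if x \<le> d then (if x < d then f x else g d) else g x) = ?h" by auto
  ultimately show ?thesis by (simp only:)
qed

lemma C1_differentiable_onI:
  assumes "\<And>x. x \<in> S \<Longrightarrow> (f has_real_derivative f' x) (at x)" "continuous_on S f'"
  shows "f C1_differentiable_on S"
  using assms unfolding C1_differentiable_on_def
  by (auto simp: has_real_derivative_iff_has_vector_derivative)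

lemma C1_differentiable_on_inverse:
  fixes f :: "real \<Rightarrow> real"
  assumes f: "f C1_differentiable_on S" and nz: "\<And>x. x \<in> S \<Longrightarrow> f x \<noteq> 0"
  shows "(\<lambda>x. inverse (f x)) C1_differentiable_on S"
proof -
  obtain D where D: "\<And>x. x \<in> S \<Longrightarrow> (f has_real_derivative D x) (at x)" "continuous_on S D"
    using f unfolding C1_differentiable_on_def
    by (auto simp: has_real_derivative_iff_has_vector_derivative)
  have "continuous_on S f" using f by (rule C1_differentiable_imp_continuous_on)
  then show ?thesis
    by (intro C1_differentiable_onI[where f' = "\<lambda>x. - (inverse (f x) * D x * inverse (f x))"])
      (auto intro!: derivative_eq_intros continuous_intros D simp: nz)
qed

lemma C1_differentiable_on_power:
  fixes f :: "real \<Rightarrow> real"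
  shows "f C1_differentiable_on S \<Longrightarrow> (\<lambda>x. f x ^ n) C1_differentiable_on S"
  by (induction n) auto

text \<open>A bounded derivative makes \<open>f\<close> Lipschitz, hence uniformly continuous, and a
  uniformly continuous function extends to the closure of its domain.\<close>

lemma tendsto_at_left_of_bounded_deriv:
  fixes f f' :: "real \<Rightarrow> real"
  assumes "a < b" and D: "\<And>x. x \<in> {a<..<b} \<Longrightarrow> (f has_real_derivative f' x) (at x)"
    and B: "\<And>x. x \<in> {a<..<b} \<Longrightarrow> \<bar>f' x\<bar> \<le> B"
  shows "\<exists>l. (f \<longlongrightarrow> l) (at_left b)"
proof -
  have "B-lipschitz_on {a<..<b} f"
  proof (rule bounded_derivative_imp_lipschitz)
    show "(f has_derivative (*) (f' x)) (at x within {a<..<b})" if "x \<in> {a<..<b}" for x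
      using D[OF that] by (simp add: has_field_derivative_def has_derivative_at_withinI)
    show "onorm ((*) (f' x)) \<le> B" if "x \<in> {a<..<b}" for x
      using B[OF that] by (intro onorm_le) (simp add: abs_mult mult_right_mono)
    have "\<bar>f' ((a+b)/2)\<bar> \<le> B" using \<open>a < b\<close> by (intro B) auto
    then show "0 \<le> B" by linarith
  qed auto
  then have "uniformly_continuous_on {a<..<b} f" by (rule lipschitz_on_uniformly_continuous)
  moreover have "b \<in> closure {a<..<b}" using \<open>a < b\<close> by simp
  ultimately obtain l where "(f \<longlongrightarrow> l) (at b within {a<..<b})"
    by (rule uniformly_continuous_on_extension_at_closure)
  moreover have "at b within {a<..<b} = at_left b"
    by (rule at_within_nhd[of _ "{a<..}"]) (use \<open>a < b\<close> in auto)
  ultimately show ?thesis by auto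
qed

section \<open>The pressure law near zero density\<close>

locale barotrope =
  fixes c A \<gamma> :: real and \<Omega> P :: "real \<Rightarrow> real"
  assumes c_pos: "0 < c" and law: "pressure_law c A \<gamma> \<Omega> P"
begin

lemma A_pos: "0 < A" and \<gamma>_gt_1: "1 < \<gamma>" and \<gamma>_less_2: "\<gamma> < 2"
  using law by (auto simp: pressure_law_def)

lemma P_pos: "0 < \<rho> \<Longrightarrow> 0 < P \<rho>"
  and deriv_P_pos: "0 < \<rho> \<Longrightarrow> 0 < deriv P \<rho>"
  using law by (auto simp: pressure_law_def)

lemma DERIV_P: "0 < \<rho> \<Longrightarrow> (P has_real_derivative deriv P \<rho>) (at \<rho>)"
  using law by (auto simp: pressure_law_def field_differentiable_derivI)

text \<open>Factoring the leading powers out of \<open>P\<close> and \<open>deriv P\<close> leaves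
  \<open>k\<close> and \<open>h\<close>, which stay continuous down to density 0 because \<gamma> >
  1 and \<open>\<Omega>\<close>, \<open>deriv \<Omega>\<close> are continuous on
  \<open>{0..}\<close>. The behaviour near vacuum is read off from them; in fact
  \<open>h 0 = A * \<gamma>\<close>.\<close>

lemma pressure_asymptotics:
  obtains h k where "continuous_on {0..} h" "continuous_on {0..} k" "0 < h 0" "k 0 = 0"
    "\<And>\<rho>. 0 < \<rho> \<Longrightarrow> P \<rho> = \<rho> * k \<rho>"
    "\<And>\<rho>. 0 < \<rho> \<Longrightarrow> deriv P \<rho> = \<rho> powr (\<gamma> - 1) * h \<rho>"
proof -
  obtain U where U: "{0..} \<subseteq> U" "real_analytic_on \<Omega> U"
    using law unfolding pressure_law_def by blast
  have \<Omega>0: "\<Omega> 0 = 1" using law unfolding pressure_law_def by blast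
  have P_eq: "P \<rho> = A * \<rho> powr \<gamma> * \<Omega> (A * \<rho> powr (\<gamma> - 1) / c\<^sup>2)" if "0 < \<rho>" for \<rho>
    using law that unfolding pressure_law_def by blast
  have D\<Omega>: "(\<Omega> has_real_derivative deriv \<Omega> y) (at y)" and C\<Omega>': "isCont (deriv \<Omega>) y" if "0 \<le> y" for y
    using real_analytic_on_has_derivative[OF U(2)] U(1) that by auto
  define x where "x = (\<lambda>\<rho>. A * \<rho> powr (\<gamma> - 1) / c\<^sup>2)"
  \<comment> \<open>Product and chain rule give the two summands; in the second,
    \<open>\<rho> powr \<gamma> * \<rho> powr (\<gamma> - 2)\<close> is the square of
    \<open>\<rho> powr (\<gamma> - 1)\<close>, of which one factor is pulled out.\<close>
  define h where "h = (\<lambda>\<rho>. A * \<gamma> * \<Omega> (x \<rho>) + A\<^sup>2 * (\<gamma> - 1) / c\<^sup>2 * \<rho> powr (\<gamma> - 1) * deriv \<Omega> (x \<rho>))"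
  define k where "k = (\<lambda>\<rho>. A * \<rho> powr (\<gamma> - 1) * \<Omega> (x \<rho>))"
  have powr: "continuous_on {0..} (\<lambda>\<rho>. \<rho> powr (\<gamma> - 1))"
    by (intro continuous_on_powr' continuous_intros) (use \<gamma>_gt_1 in auto)
  have x: "continuous_on {0..} x" unfolding x_def
    by (intro continuous_intros powr) (use c_pos in auto)
  have x_nonneg: "0 \<le> x \<rho>" for \<rho> using A_pos by (simp add: x_def)
  have "continuous_on {0..} \<Omega>" "continuous_on {0..} (deriv \<Omega>)"
    using DERIV_isCont[OF D\<Omega>] C\<Omega>' by (auto intro!: continuous_at_imp_continuous_on)
  then have \<Omega>x: "continuous_on {0..} (\<lambda>\<rho>. \<Omega> (x \<rho>))" "continuous_on {0..} (\<lambda>\<rho>. deriv \<Omega> (x \<rho>))"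
    by (auto intro!: continuous_on_compose2[of "{0..}" _ _ x] x simp: x_nonneg)
  show thesis
  proof
    show "continuous_on {0..} h" "continuous_on {0..} k"
      unfolding h_def k_def by (intro continuous_intros powr \<Omega>x; use c_pos in auto)+
    show "0 < h 0" "k 0 = 0"
      using A_pos \<gamma>_gt_1 by (simp_all add: h_def k_def x_def \<Omega>0)
    fix \<rho> :: real assume \<rho>: "0 < \<rho>"
    have pw: "\<rho> powr \<gamma> = \<rho> * \<rho> powr (\<gamma> - 1)" using \<rho> by (simp add: powr_mult_base)
    then show "P \<rho> = \<rho> * k \<rho>" by (simp add: P_eq[OF \<rho>] k_def x_def)
    have "(x has_real_derivative A * ((\<gamma> - 1) * \<rho> powr (\<gamma> - 1 - 1)) / c\<^sup>2) (at \<rho>)"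
      unfolding x_def by (intro DERIV_cdivide DERIV_cmult has_real_derivative_powr \<rho>)
    then have Dx: "(x has_real_derivative A * ((\<gamma> - 1) * \<rho> powr (\<gamma> - 2)) / c\<^sup>2) (at \<rho>)"
      by simp
    have "((\<lambda>\<rho>. A * \<rho> powr \<gamma> * \<Omega> (x \<rho>)) has_real_derivative
        A * (\<gamma> * \<rho> powr (\<gamma> - 1)) * \<Omega> (x \<rho>) +
        deriv \<Omega> (x \<rho>) * (A * ((\<gamma> - 1) * \<rho> powr (\<gamma> - 2)) / c\<^sup>2) * (A * \<rho> powr \<gamma>)) (at \<rho>)"
      by (rule DERIV_mult DERIV_chain2[OF D\<Omega>[OF x_nonneg] Dx] DERIV_cmult has_real_derivative_powr \<rho>)+
    also have "A * (\<gamma> * \<rho> powr (\<gamma> - 1)) * \<Omega> (x \<rho>) +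
        deriv \<Omega> (x \<rho>) * (A * ((\<gamma> - 1) * \<rho> powr (\<gamma> - 2)) / c\<^sup>2) * (A * \<rho> powr \<gamma>) = \<rho> powr (\<gamma> - 1) * h \<rho>"
    proof -
      have "\<rho> powr (\<gamma> - 1) = \<rho> * \<rho> powr (\<gamma> - 2)" using \<rho> by (simp add: powr_mult_base)
      then show ?thesis using c_pos by (simp add: h_def pw field_simps power2_eq_square)
    qed
    finally have "((\<lambda>\<rho>. A * \<rho> powr \<gamma> * \<Omega> (x \<rho>)) has_real_derivative \<rho> powr (\<gamma> - 1) * h \<rho>) (at \<rho>)" .
    then have "(P has_real_derivative \<rho> powr (\<gamma> - 1) * h \<rho>) (at \<rho>)"
      \<comment> \<open>The ball of radius \<open>\<rho>\<close> around \<open>\<rho>\<close>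
        contains only positive densities, where the formula for \<open>P\<close> is valid.\<close>
      by (rule has_field_derivative_transform_within[where d = \<rho>])
        (use \<rho> in \<open>auto simp: P_eq x_def dist_real_def\<close>)
    then show "deriv P \<rho> = \<rho> powr (\<gamma> - 1) * h \<rho>" by (rule DERIV_imp_deriv)
  qed
qed

lemma continuous_on_P: "continuous_on {0<..} P"
  using DERIV_P DERIV_isCont by (blast intro: continuous_at_imp_continuous_on)

lemma continuous_on_deriv_P: "continuous_on {0<..} (deriv P)"
proof -
  obtain h k where h: "continuous_on {0..} h" and k: "continuous_on {0..} k"
    and h0: "0 < h 0" and k0: "k 0 = 0"
    and P_eq: "\<And>\<rho>. 0 < \<rho> \<Longrightarrow> P \<rho> = \<rho> * k \<rho>"
    and P'_eq: "\<And>\<rho>. 0 < \<rho> \<Longrightarrow> deriv P \<rho> = \<rho> powr (\<gamma> - 1) * h \<rho>"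
    using pressure_asymptotics by metis
  have "continuous_on {0<..} (\<lambda>\<rho>. \<rho> powr (\<gamma> - 1) * h \<rho>)"
    by (intro continuous_intros continuous_on_subset[OF h]) auto
  then show ?thesis by (subst continuous_on_cong[OF refl P'_eq]) auto
qed

section \<open>Density as a function of pressure\<close>

lemma P_strict_mono: "0 < x \<Longrightarrow> x < y \<Longrightarrow> P x < P y"
  by (rule DERIV_pos_imp_increasing[of _ _ P]) (auto intro: DERIV_P deriv_P_pos dest: less_le_trans)

lemma P_less_cancel: "0 < x \<Longrightarrow> 0 < y \<Longrightarrow> P x < P y \<Longrightarrow> x < y"
  using P_strict_mono[of y x] by (cases x y rule: linorder_cases) auto

lemma density_P: "0 < \<rho> \<Longrightarrow> density P (P \<rho>) = \<rho>"
  unfolding density_def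
  by (rule the_inv_into_f_f) (auto intro!: linorder_inj_onI dest: P_strict_mono)

text \<open>Inverse function theorem: on the open half-line \<open>P\<close> is continuous with
  nonzero slope, and \<open>density P\<close> is a left inverse of it.\<close>

lemma DERIV_density:
  assumes "0 < \<rho>"
  shows "(density P has_real_derivative inverse (deriv P \<rho>)) (at (P \<rho>))"
  unfolding has_field_derivative_def
proof (rule has_derivative_inverse_strong[of "{0<..}" \<rho> P _ "(*) (deriv P \<rho>)"])
  show "(P has_derivative (*) (deriv P \<rho>)) (at \<rho>)"
    using DERIV_P[OF assms] by (simp add: has_field_derivative_def)
  show "(*) (deriv P \<rho>) \<circ> (*) (inverse (deriv P \<rho>)) = id"
    using deriv_P_pos[OF assms] by (simp add: fun_eq_iff)
qed (use assms continuous_on_P density_P in auto)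

text \<open>After cancelling powers the quotient is \<open>\<rho> powr (2 - \<gamma>) * (1 + k
  \<rho> / c\<^sup>2) / h \<rho>\<close>. The first factor vanishes in the limit since \<gamma> < 2,
  and the rest stays bounded since \<open>0 < h 0\<close>.\<close>

lemma tendsto_enthalpy_density_ratio:
  "((\<lambda>\<rho>. (\<rho> + P \<rho> / c\<^sup>2) / deriv P \<rho>) \<longlongrightarrow> 0) (at_right 0)"
proof -
  obtain h k where h: "continuous_on {0..} h" and k: "continuous_on {0..} k"
    and h0: "0 < h 0" and k0: "k 0 = 0"
    and P_eq: "\<And>\<rho>. 0 < \<rho> \<Longrightarrow> P \<rho> = \<rho> * k \<rho>"
    and P'_eq: "\<And>\<rho>. 0 < \<rho> \<Longrightarrow> deriv P \<rho> = \<rho> powr (\<gamma> - 1) * h \<rho>"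
    using pressure_asymptotics by metis
  have lim: "(f \<longlongrightarrow> f 0) (at_right 0)" if "continuous_on {0..} f" for f :: "real \<Rightarrow> real"
  proof (rule tendsto_within_subset)
    show "(f \<longlongrightarrow> f 0) (at 0 within {0..})" using that by (simp add: continuous_on_def)
  qed auto
  have "continuous_on {0..} (\<lambda>\<rho>::real. \<rho> powr (2 - \<gamma>))"
    by (intro continuous_on_powr' continuous_intros) (use \<gamma>_less_2 in auto)
  from lim[OF this] have "((\<lambda>\<rho>::real. \<rho> powr (2 - \<gamma>)) \<longlongrightarrow> 0) (at_right 0)" by simp
  then have "((\<lambda>\<rho>. \<rho> powr (2 - \<gamma>) * (1 + k \<rho> / c\<^sup>2) / h \<rho>) \<longlongrightarrow> 0 * (1 + k 0 / c\<^sup>2) / h 0) (at_right 0)"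
    by (intro tendsto_intros lim h k) (use h0 c_pos in auto)
  then have "((\<lambda>\<rho>. \<rho> powr (2 - \<gamma>) * (1 + k \<rho> / c\<^sup>2) / h \<rho>) \<longlongrightarrow> 0) (at_right 0)" by simp
  then show ?thesis
  proof (rule Lim_transform_eventually)
    have "\<rho> powr (2 - \<gamma>) * (1 + k \<rho> / c\<^sup>2) / h \<rho> = (\<rho> + P \<rho> / c\<^sup>2) / deriv P \<rho>" if "0 < \<rho>" for \<rho>
    proof -
      have "\<rho> powr (2 - \<gamma>) * \<rho> powr (\<gamma> - 1) = \<rho>" using that by (simp add: powr_add[symmetric])
      then have "(\<rho> + P \<rho> / c\<^sup>2) / deriv P \<rho> =
          (\<rho> powr (2 - \<gamma>) * \<rho> powr (\<gamma> - 1)) * (1 + k \<rho> / c\<^sup>2) / (\<rho> powr (\<gamma> - 1) * h \<rho>)"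
        by (simp add: P_eq P'_eq that algebra_simps)
      then show ?thesis using that by simp
    qed
    then show "\<forall>\<^sub>F \<rho> in at_right 0. \<rho> powr (2 - \<gamma>) * (1 + k \<rho> / c\<^sup>2) / h \<rho> = (\<rho> + P \<rho> / c\<^sup>2) / deriv P \<rho>"
      by (simp add: eventually_at_filter)
  qed
qed

section \<open>The variable u as a function of the density\<close>

lemma u_integrable: "(\<lambda>s. deriv P s / (s + P s / c\<^sup>2)) integrable_on {0..b}"
proof (cases "0 \<le> b")
  case True
  obtain h k where h: "continuous_on {0..} h" and k: "continuous_on {0..} k"
    and h0: "0 < h 0" and k0: "k 0 = 0"
    and P_eq: "\<And>\<rho>. 0 < \<rho> \<Longrightarrow> P \<rho> = \<rho> * k \<rho>"
    and P'_eq: "\<And>\<rho>. 0 < \<rho> \<Longrightarrow> deriv P \<rho> = \<rho> powr (\<gamma> - 1) * h \<rho>"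
    using pressure_asymptotics by metis
  \<comment> \<open>Positivity of the pressure forces the sign of \<open>k\<close>, which keeps the
    denominator \<open>1 + k s / c\<^sup>2\<close> away from zero on the whole interval.\<close>
  have k_nonneg: "0 \<le> k s" if "0 \<le> s" for s
  proof (cases "s = 0")
    case False
    then have "0 < s * k s" using that P_pos[of s] P_eq[of s] by simp
    then show ?thesis using that by (simp add: zero_less_mult_iff)
  qed (simp add: k0)
  have nz: "1 + k s / c\<^sup>2 \<noteq> 0" if "0 \<le> s" for s
    using k_nonneg[OF that] by (simp add: add_pos_nonneg order_less_imp_not_eq2)
  define f where "f = (\<lambda>s. h s / (1 + k s / c\<^sup>2))"
  have f: "continuous_on {0..b} f" unfolding f_def
    by (intro continuous_intros continuous_on_subset[OF h] continuous_on_subset[OF k])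
      (use c_pos nz in auto)
  have "(\<lambda>s. f s * s powr (\<gamma> - 2)) absolutely_integrable_on {0..b}"
  proof (rule absolutely_integrable_bounded_measurable_product_real)
    show "f \<in> borel_measurable (lebesgue_on {0..b})"
      using f by (intro continuous_imp_measurable_on_sets_lebesgue) auto
    show "bounded (f ` {0..b})"
      using f by (intro compact_imp_bounded compact_continuous_image) auto
    have "(\<lambda>s. s powr (\<gamma> - 2)) integrable_on {0..b}"
      by (rule integrable_on_powr_from_0) (use True \<gamma>_gt_1 in auto)
    then show "(\<lambda>s. s powr (\<gamma> - 2)) absolutely_integrable_on {0..b}"
      by (intro nonnegative_absolutely_integrable_1) auto
  qed auto
  then have "(\<lambda>s. f s * s powr (\<gamma> - 2)) integrable_on {0..b}"
    by (rule set_lebesgue_integral_eq_integral(1))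
  then show ?thesis
  \<comment> \<open>The factorizations hold at positive densities only; the single endpoint 0 does
    not affect the integral.\<close>
  proof (rule integrable_spike_finite[of "{0}", rotated 2])
    fix s assume "s \<in> {0..b} - {0}"
    then have s: "0 < s" by auto
    have "s powr (\<gamma> - 1) = s * s powr (\<gamma> - 2)" using s by (simp add: powr_mult_base)
    then have "deriv P s / (s + P s / c\<^sup>2) = (s * (s powr (\<gamma> - 2) * h s)) / (s * (1 + k s / c\<^sup>2))"
      using s by (simp add: P_eq P'_eq algebra_simps)
    then show "deriv P s / (s + P s / c\<^sup>2) = f s * s powr (\<gamma> - 2)"
      using s by (simp add: f_def mult.commute)
  qed auto
qed auto

lemma DERIV_u_of_density:
  assumes "0 < \<rho>"
  shows "(u_of_density c P has_real_derivative deriv P \<rho> / (\<rho> + P \<rho> / c\<^sup>2)) (at \<rho>)"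
proof -
  let ?f = "\<lambda>s. deriv P s / (s + P s / c\<^sup>2)"
  have nz: "s + P s / c\<^sup>2 \<noteq> 0" if "0 < s" for s
    using P_pos[OF that] c_pos that by (simp add: add_pos_pos order_less_imp_not_eq2)
  have "continuous_on {0<..} ?f"
    by (intro continuous_intros continuous_on_P continuous_on_deriv_P) (use c_pos nz in auto)
  then have "isCont ?f \<rho>"
    using assms by (simp add: continuous_on_eq_continuous_at)
  then have "((\<lambda>u. integral {0..u} ?f) has_vector_derivative ?f \<rho>) (at \<rho> within {0..\<rho> + 1} - {})"
    using assms by (intro integral_has_vector_derivative_continuous_at u_integrable)
      (auto intro: continuous_at_imp_continuous_at_within)
  moreover have "at \<rho> within {0..\<rho> + 1} = at \<rho>"
    by (rule at_within_interior) (use assms in auto)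
  ultimately show ?thesis
    by (simp add: u_of_density_def[abs_def] has_real_derivative_iff_has_vector_derivative)
qed

text \<open>An indefinite integral is continuous up to its lower limit, where the interval
  degenerates and the value is 0.\<close>

lemma tendsto_u_of_density: "(u_of_density c P \<longlongrightarrow> 0) (at_right 0)"
proof -
  have "continuous_on {0..1} (u_of_density c P)"
    unfolding u_of_density_def[abs_def] by (rule indefinite_integral_continuous_1[OF u_integrable])
  then have "(u_of_density c P \<longlongrightarrow> u_of_density c P 0) (at 0 within {0..1})"
    by (simp add: continuous_on_def)
  moreover have "at (0::real) within {0..1} = at_right 0"
    by (rule at_within_nhd[of _ "{..<1}"]) auto
  ultimately show ?thesis by (simp add: u_of_density_def)
qed

end

section \<open>Horizons and the boundary of the star\<close>

lemma DERIV_piecewise: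
  fixes f g :: "real \<Rightarrow> real"
  assumes "x \<noteq> d" "x < d \<Longrightarrow> (f has_real_derivative D) (at x)"
    "d < x \<Longrightarrow> (g has_real_derivative D) (at x)"
  shows "((\<lambda>x. if x < d then f x else g x) has_real_derivative D) (at x)"
proof (cases "x < d")
  case True
  show ?thesis
    by (rule has_field_derivative_transform_within_open[OF assms(2)[OF True], of "{..<d}"])
      (use True in auto)
next
  case False
  then have "d < x" using assms(1) by simp
  show ?thesis
    by (rule has_field_derivative_transform_within_open[OF assms(3)[OF \<open>d < x\<close>], of "{d<..}"])
      (use \<open>d < x\<close> in auto)
qed

text \<open>\<open>r \<cdot> \<kappa>(r, M)\<close> is a cubic without quadratic term, so its third root is \<open>-(r\<^sub>I + r\<^sub>E)\<close>.\<close>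

lemma horizons_exist:
  assumes "0 < c" "0 < G" "0 < \<Lambda>" "0 < rp" "0 < M" and pos: "0 < kappa c G \<Lambda> rp M"
  shows "\<exists>rI rE. horizons c G \<Lambda> rp M rI rE"
proof -
  define a b where "a = 2 * G * M / c\<^sup>2" and "b = \<Lambda> / 3"
  define f where "f = (\<lambda>r::real. r - a - b * r ^ 3)"
  have ab: "0 < a" "0 < b" using assms by (simp_all add: a_def b_def)
  have kf: "kappa c G \<Lambda> r M = f r / r" if "0 < r" for r
    using that \<open>0 < c\<close>
    by (simp add: kappa_def f_def a_def b_def field_simps power2_eq_square power3_eq_cube)
  have cont: "continuous_on S f" for S unfolding f_def by (intro continuous_intros)
  have frp: "0 < f rp" using pos kf[OF \<open>0 < rp\<close>] \<open>0 < rp\<close> by (simp add: zero_less_divide_iff)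
  \<comment> \<open>\<open>f 0 = - a\<close> is negative while \<open>f rp\<close> is
    positive.\<close>
  obtain rI where rI: "0 \<le> rI" "rI \<le> rp" "f rI = 0"
    using IVT'[of f 0 0 rp, OF _ _ _ cont] frp ab \<open>0 < rp\<close> by (auto simp: f_def)
  \<comment> \<open>\<open>R\<close> is chosen so that \<open>1 / b \<le> R \<le> R * R\<close>;
    then \<open>b * R ^ 3\<close> is at least \<open>R\<close>, which makes \<open>f R\<close>
    nonpositive and yields a second root beyond \<open>rp\<close>.\<close>
  define R where "R = 1 + rp + 1 / b"
  have "1 \<le> R" "1 / b \<le> R" using ab \<open>0 < rp\<close> by (auto simp: R_def)
  then have "1 / b * 1 \<le> R * R" using ab by (intro mult_mono) auto
  then have "1 \<le> b * (R * R)" using ab by (simp add: field_simps)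
  then have "R * 1 \<le> R * (b * (R * R))" using \<open>1 \<le> R\<close> by (intro mult_left_mono) auto
  then have "f R \<le> 0" using ab by (simp add: f_def power3_eq_cube algebra_simps)
  moreover have "rp \<le> R" using ab by (simp add: R_def)
  ultimately obtain rE where rE: "rp \<le> rE" "f rE = 0"
    using IVT2'[of f R 0 rp, OF _ _ _ cont] frp by auto
  have ne: "rI \<noteq> 0" "rI \<noteq> rp" "rp \<noteq> rE" using rI rE frp ab by (auto simp: f_def)
  have lt: "0 < rI" "rI < rp" "rp < rE" using ne rI rE by auto
  \<comment> \<open>Both roots annihilate \<open>f\<close>, so its difference quotient between them
    vanishes. The resulting identity \<open>b1\<close> lets \<open>fac\<close> replace the constant
    1 and split off the factor \<open>rE - r\<close>.\<close>
  have "(rE - rI) * (1 - b * (rE\<^sup>2 + rE * rI + rI\<^sup>2)) = f rE - f rI"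
    by (simp add: f_def algebra_simps power2_eq_square power3_eq_cube)
  then have b1: "b * (rE\<^sup>2 + rE * rI + rI\<^sup>2) = 1" using rI rE lt by simp
  have fac: "f r = (r - rI) * (b * ((rE - r) * (rE + r + rI)))" for r
  proof -
    have "f r = f r - f rI" using rI by simp
    also have "\<dots> = (r - rI) * (1 - b * (r\<^sup>2 + r * rI + rI\<^sup>2))"
      by (simp add: f_def algebra_simps power2_eq_square power3_eq_cube)
    also have "\<dots> = (r - rI) * (b * (rE\<^sup>2 + rE * rI + rI\<^sup>2) - b * (r\<^sup>2 + r * rI + rI\<^sup>2))"
      by (simp only: b1)
    finally show ?thesis by (simp add: algebra_simps power2_eq_square)
  qed
  have "0 < kappa c G \<Lambda> r M \<longleftrightarrow> rI < r \<and> r < rE" if "0 < r" for r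
  proof -
    \<comment> \<open>\<open>w\<close> collects the contributions without a sign change at positive
      radius, among them the factor of the negative root.\<close>
    define w where "w = b * (rE + r + rI) / r"
    have "0 < w" using that lt ab by (simp add: w_def)
    have "kappa c G \<Lambda> r M = (r - rI) * (rE - r) * w"
      unfolding kf[OF that] fac[of r] w_def by simp
    then have "0 < kappa c G \<Lambda> r M \<longleftrightarrow> 0 < (r - rI) * (rE - r)"
      using \<open>0 < w\<close> by (simp add: zero_less_mult_iff[of _ w])
    also have "\<dots> \<longleftrightarrow> rI < r \<and> r < rE"
      using lt by (subst zero_less_mult_iff) linarith
    finally show ?thesis .
  qed
  then show ?thesis using lt unfolding horizons_def by blast
qed

section \<open>The stellar interior and its limits at the surface\<close>

locale tov_star = barotrope +
  fixes G \<Lambda> rp :: real and m p :: "real \<Rightarrow> real"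
  assumes G_pos: "0 < G" and \<Lambda>_pos: "0 < \<Lambda>" and star: "monotone_short c G \<Lambda> P rp m p"
begin

definition \<rho> :: "real \<Rightarrow> real" where "\<rho> r = density P (p r)"

abbreviation "M \<equiv> m_plus rp m"

lemma rp_pos: "0 < rp" and p_lim: "(p \<longlongrightarrow> 0) (at_left rp)"
  using star by (auto simp: monotone_short_def)

context
  fixes r assumes r: "0 < r" "r < rp"
begin

lemma \<rho>_pos: "0 < \<rho> r" and P_\<rho>: "P (\<rho> r) = p r" and kappa_interior_pos: "0 < kappa c G \<Lambda> r (m r)"
proof -
  have dom: "(r, m r, p r) \<in> tov_domain c G \<Lambda> P"
    using star r by (simp add: monotone_short_def tov_solution_def)
  then obtain s where "0 < s" "p r = P s" by (auto simp: tov_domain_def)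
  then show "0 < \<rho> r" "P (\<rho> r) = p r" by (simp_all add: \<rho>_def density_P)
  show "0 < kappa c G \<Lambda> r (m r)" using dom by (simp add: tov_domain_def)
qed

lemma DERIV_m: "(m has_real_derivative 4 * pi * r\<^sup>2 * \<rho> r) (at r)"
  and DERIV_p: "(p has_real_derivative
      - (\<rho> r + p r / c\<^sup>2) * (Q_fun c G \<Lambda> r (m r) (p r) / (r\<^sup>2 * kappa c G \<Lambda> r (m r)))) (at r)"
proof -
  have "r \<in> {0<..<rp}" using r by simp
  then show "(m has_real_derivative 4 * pi * r\<^sup>2 * \<rho> r) (at r)"
    and "(p has_real_derivative
      - (\<rho> r + p r / c\<^sup>2) * (Q_fun c G \<Lambda> r (m r) (p r) / (r\<^sup>2 * kappa c G \<Lambda> r (m r)))) (at r)"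
    using star unfolding monotone_short_def tov_solution_def \<rho>_def by blast+
qed

text \<open>Chain rule for \<open>density P\<close> and \<open>p\<close>. Writing
  \<open>P (\<rho> r)\<close> instead of \<open>p r\<close> makes the coefficient a function of the
  density alone, so that its limit at zero density can be composed with
  \<open>\<rho>\<close>.\<close>

lemma DERIV_\<rho>: "(\<rho> has_real_derivative - ((\<rho> r + P (\<rho> r) / c\<^sup>2) / deriv P (\<rho> r) *
    (Q_fun c G \<Lambda> r (m r) (p r) / (r\<^sup>2 * kappa c G \<Lambda> r (m r))))) (at r)"
proof -
  have "(density P has_real_derivative inverse (deriv P (\<rho> r))) (at (p r))"
    using DERIV_density[OF \<rho>_pos] by (simp add: P_\<rho>)
  from DERIV_chain2[OF this DERIV_p] show ?thesis
    by (simp add: \<rho>_def[abs_def] P_\<rho>[unfolded \<rho>_def] divide_inverse algebra_simps)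
qed

text \<open>The slope of \<open>u_of_density\<close> is the reciprocal of the enthalpy ratio in the
  slope of \<open>\<rho>\<close>, so the equation of state cancels in the chain rule.\<close>

lemma DERIV_u_sol: "(u_sol c P p has_real_derivative
    - (Q_fun c G \<Lambda> r (m r) (p r) / (r\<^sup>2 * kappa c G \<Lambda> r (m r)))) (at r)"
proof -
  have "0 < \<rho> r + P (\<rho> r) / c\<^sup>2" using \<rho>_pos P_pos[OF \<rho>_pos] c_pos by (simp add: add_pos_pos)
  then show ?thesis
    using DERIV_chain2[OF DERIV_u_of_density[OF \<rho>_pos] DERIV_\<rho>] deriv_P_pos[OF \<rho>_pos]
    by (simp add: u_sol_def[abs_def] \<rho>_def)
qed

end

lemma eventually_interior: "\<forall>\<^sub>F r in at_left rp. 0 < r \<and> r < rp"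
  using rp_pos eventually_at_left_field by blast

text \<open>Strict monotonicity of \<open>P\<close> turns smallness of the pressure into smallness
  of the density. The target filter is \<open>at_right 0\<close> because the laws near vacuum are
  limits from positive densities.\<close>

lemma \<rho>_lim: "filterlim \<rho> (at_right 0) (at_left rp)"
proof -
  have "(\<rho> \<longlongrightarrow> 0) (at_left rp)"
  proof (rule order_tendstoI)
    fix e :: real assume e: "e < 0"
    show "\<forall>\<^sub>F r in at_left rp. e < \<rho> r"
      using eventually_interior by eventually_elim (meson \<rho>_pos e less_trans)
  next
    fix e :: real assume e: "0 < e"
    have "\<forall>\<^sub>F r in at_left rp. p r < P e" using order_tendstoD(2)[OF p_lim P_pos[OF e]] .
    with eventually_interior show "\<forall>\<^sub>F r in at_left rp. \<rho> r < e"
      by eventually_elim (metis P_less_cancel P_\<rho> \<rho>_pos e)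
  qed
  moreover have "\<forall>\<^sub>F r in at_left rp. \<rho> r \<in> {0<..}"
    using eventually_interior by eventually_elim (simp add: \<rho>_pos)
  ultimately show ?thesis by (simp add: filterlim_at eventually_mono)
qed

text \<open>\<open>m_plus\<close> is a \<open>Lim\<close>, so existence has to be established first.
  Near the surface the density is below 1 (any fixed bound would do), hence the slope of
  \<open>m\<close> is bounded there.\<close>

lemma m_lim: "(m \<longlongrightarrow> M) (at_left rp)"
proof -
  have "\<forall>\<^sub>F r in at_left rp. \<rho> r < 1"
    using order_tendstoD(2)[of \<rho> 0 "at_left rp" 1] \<rho>_lim by (simp add: filterlim_at)
  then obtain b where b: "b < rp" "\<And>r. b < r \<Longrightarrow> r < rp \<Longrightarrow> \<rho> r < 1"
    by (auto simp: eventually_at_left_field)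
  have "\<exists>l. (m \<longlongrightarrow> l) (at_left rp)"
  proof (rule tendsto_at_left_of_bounded_deriv)
    show "max 0 b < rp" using b rp_pos by simp
    fix r assume "r \<in> {max 0 b<..<rp}"
    then have r: "0 < r" "r < rp" "b < r" by auto
    show "(m has_real_derivative 4 * pi * r\<^sup>2 * \<rho> r) (at r)" using DERIV_m r by simp
    have "r\<^sup>2 * \<rho> r \<le> rp\<^sup>2 * 1"
      using r b(2)[of r] \<rho>_pos[of r] by (intro mult_mono power_mono) auto
    then show "\<bar>4 * pi * r\<^sup>2 * \<rho> r\<bar> \<le> 4 * pi * rp\<^sup>2"
      using \<rho>_pos[of r] r by (simp add: abs_mult mult.assoc)
  qed
  then show ?thesis by (auto simp: m_plus_def tendsto_Lim)
qed

lemma kappa_plus_eq: "kappa_plus c G \<Lambda> rp m = kappa c G \<Lambda> rp M"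
  unfolding kappa_plus_def kappa_def
  by (rule tendsto_Lim) (use rp_pos c_pos in \<open>auto intro!: tendsto_eq_intros m_lim\<close>)

lemma Q_plus_eq: "Q_plus c G \<Lambda> rp m p = Q_fun c G \<Lambda> rp M 0"
  unfolding Q_plus_def Q_fun_def
  by (rule tendsto_Lim) (use rp_pos c_pos in \<open>auto intro!: tendsto_eq_intros m_lim p_lim\<close>)

text \<open>With vanishing pressure, \<open>Q_plus\<close> positive says that \<open>G * M\<close>
  exceeds a positive cosmological term; this gives the positive mass needed for an inner
  horizon.\<close>

lemma horizons_M: "\<exists>rI rE. horizons c G \<Lambda> rp M rI rE"
proof (rule horizons_exist)
  show "0 < kappa c G \<Lambda> rp M" using star by (simp add: monotone_short_def kappa_plus_eq)
  have "0 < G * M - c\<^sup>2 * \<Lambda> / 3 * rp ^ 3"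
    using star by (simp add: monotone_short_def Q_plus_eq Q_fun_def)
  moreover have "0 < c\<^sup>2 * \<Lambda> / 3 * rp ^ 3" using c_pos \<Lambda>_pos rp_pos by simp
  ultimately have "0 < G * M" by linarith
  then show "0 < M" using G_pos by (simp add: zero_less_mult_iff)
qed (use c_pos G_pos \<Lambda>_pos rp_pos in auto)

end

section \<open>The patched coefficients\<close>

context tov_star
begin

definition p_tilde :: "real \<Rightarrow> real" where "p_tilde r = (if r < rp then p r else 0)"

definition \<rho>_tilde :: "real \<Rightarrow> real" where "\<rho>_tilde r = (if r < rp then \<rho> r else 0)"

definition kappa_tilde :: "real \<Rightarrow> real" where
  "kappa_tilde r = kappa c G \<Lambda> r (m_tilde rp m r)"

text \<open>Inside the star this is the negative slope of \<open>u_sol\<close>; outside, it is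
  \<open>c\<^sup>2 / 2\<close> times the logarithmic derivative of
  \<open>kappa_tilde\<close>.\<close>

definition gravity :: "real \<Rightarrow> real" where
  "gravity r = Q_fun c G \<Lambda> r (m_tilde rp m r) (p_tilde r) / (r\<^sup>2 * kappa_tilde r)"

lemma patched_metric:
  shows "r < rp \<Longrightarrow> spherical_metric c (g00 c G \<Lambda> P rp m p r) (g11 c G \<Lambda> rp m r) r =
      interior_metric c G \<Lambda> P rp m p r"
    and "rp \<le> r \<Longrightarrow> spherical_metric c (g00 c G \<Lambda> P rp m p r) (g11 c G \<Lambda> rp m r) r =
      exterior_metric c G \<Lambda> M r"
  by (simp_all add: interior_metric_def exterior_metric_def g00_def g11_def m_tilde_def kappa_def
      inverse_eq_divide)

context
  fixes rI rE assumes hor: "horizons c G \<Lambda> rp M rI rE"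
begin

lemma rp_less_rE: "rp < rE" using hor by (simp add: horizons_def)

text \<open>Inside the star the sign is part of \<open>tov_domain\<close>; outside it comes from the
  horizons, since \<open>rI < rp\<close>.\<close>

lemma kappa_tilde_pos:
  assumes "r \<in> {0<..<rE}"
  shows "0 < kappa_tilde r"
proof (cases "r < rp")
  case True
  then show ?thesis using kappa_interior_pos assms by (simp add: kappa_tilde_def m_tilde_def)
next
  case False
  then have "rI < r" "0 < r" using hor assms by (auto simp: horizons_def)
  then show ?thesis
    using hor assms False by (auto simp: horizons_def kappa_tilde_def m_tilde_def)
qed

lemma continuous_on_extension:
  fixes f g :: "real \<Rightarrow> real"
  assumes "\<And>r. 0 < r \<Longrightarrow> r < rp \<Longrightarrow> isCont f r" "continuous_on {rp..<rE} g"
    "(f \<longlongrightarrow> g rp) (at_left rp)"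
  shows "continuous_on {0<..<rE} (\<lambda>r. if r < rp then f r else g r)"
  by (rule continuous_on_piecewise)
    (use assms rp_pos rp_less_rE in \<open>auto intro: continuous_at_imp_continuous_on\<close>)

text \<open>One formula \<open>F\<close> must serve both sides and be continuous across
  \<open>rp\<close>; the derivative at \<open>rp\<close> itself then follows from
  \<open>DERIV_interior_point\<close>.\<close>

lemma DERIV_extension:
  assumes "\<And>r. 0 < r \<Longrightarrow> r < rp \<Longrightarrow> (f has_real_derivative F r) (at r)"
    "\<And>r. rp < r \<Longrightarrow> r < rE \<Longrightarrow> (g has_real_derivative F r) (at r)"
    "continuous_on {0<..<rE} (\<lambda>r. if r < rp then f r else g r)" "continuous_on {0<..<rE} F"
    "r \<in> {0<..<rE}"
  shows "((\<lambda>r. if r < rp then f r else g r) has_real_derivative F r) (at r)"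
proof (rule DERIV_interior_point[of rp 0 rE])
  show "((\<lambda>r. if r < rp then f r else g r) has_real_derivative F x) (at x)"
    if "x \<in> {0<..<rE}" "x \<noteq> rp" for x
    using that assms by (intro DERIV_piecewise) auto
qed (use assms rp_pos rp_less_rE in auto)

section \<open>Regularity of the continued mass, pressure and density\<close>

lemma continuous_on_m_tilde: "continuous_on {0<..<rE} (m_tilde rp m)"
  unfolding m_tilde_def[abs_def]
  by (intro continuous_on_extension m_lim DERIV_isCont[OF DERIV_m]) auto

lemma continuous_on_p_tilde: "continuous_on {0<..<rE} p_tilde"
  unfolding p_tilde_def[abs_def]
  by (intro continuous_on_extension p_lim DERIV_isCont[OF DERIV_p]) auto

lemma continuous_on_\<rho>_tilde: "continuous_on {0<..<rE} \<rho>_tilde"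
proof -
  have "(\<rho> \<longlongrightarrow> 0) (at_left rp)" using \<rho>_lim by (simp add: filterlim_at)
  then show ?thesis
    unfolding \<rho>_tilde_def[abs_def]
    by (intro continuous_on_extension DERIV_isCont[OF DERIV_\<rho>]) auto
qed

lemma continuous_on_kappa_tilde: "continuous_on {0<..<rE} kappa_tilde"
  unfolding kappa_tilde_def[abs_def] kappa_def
  by (intro continuous_intros continuous_on_m_tilde) (use c_pos in auto)

lemma continuous_on_gravity: "continuous_on {0<..<rE} gravity"
proof -
  have "r\<^sup>2 * kappa_tilde r \<noteq> 0" if "r \<in> {0<..<rE}" for r
    using kappa_tilde_pos[OF that] that by simp
  then show ?thesis
    unfolding gravity_def[abs_def] Q_fun_def
    by (intro continuous_intros continuous_on_m_tilde continuous_on_p_tilde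
        continuous_on_kappa_tilde) (use c_pos in auto)
qed

lemma DERIV_m_tilde:
  assumes "r \<in> {0<..<rE}"
  shows "(m_tilde rp m has_real_derivative 4 * pi * r\<^sup>2 * \<rho>_tilde r) (at r)"
  unfolding m_tilde_def[abs_def]
proof (rule DERIV_extension)
  show "continuous_on {0<..<rE} (\<lambda>r. 4 * pi * r\<^sup>2 * \<rho>_tilde r)"
    by (intro continuous_intros continuous_on_\<rho>_tilde)
  show "continuous_on {0<..<rE} (\<lambda>r. if r < rp then m r else M)"
    using continuous_on_m_tilde by (simp add: m_tilde_def[abs_def])
qed (use assms DERIV_m in \<open>auto simp: \<rho>_tilde_def\<close>)

text \<open>The right-hand side of the pressure equation carries the factor
  \<open>\<rho>_tilde r + p_tilde r / c\<^sup>2\<close>, which is zero in the vacuum, so the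
  constant continuation satisfies the same equation with a continuous slope.\<close>

lemma C1_p_tilde: "p_tilde C1_differentiable_on {0<..<rE}"
proof (rule C1_differentiable_onI)
  show cont: "continuous_on {0<..<rE} (\<lambda>r. - (\<rho>_tilde r + p_tilde r / c\<^sup>2) * gravity r)"
    by (intro continuous_intros continuous_on_\<rho>_tilde continuous_on_p_tilde continuous_on_gravity)
      (use c_pos in auto)
  fix r assume r: "r \<in> {0<..<rE}"
  show "(p_tilde has_real_derivative - (\<rho>_tilde r + p_tilde r / c\<^sup>2) * gravity r) (at r)"
    unfolding p_tilde_def[abs_def]
  proof (rule DERIV_extension)
    show "continuous_on {0<..<rE} (\<lambda>r. if r < rp then p r else 0)"
      using continuous_on_p_tilde by (simp add: p_tilde_def[abs_def])
    show "(p has_real_derivative - (\<rho>_tilde x + (if x < rp then p x else 0) / c\<^sup>2) * gravity x) (at x)"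
      if "0 < x" "x < rp" for x
      using DERIV_p[OF that] that
      by (simp add: \<rho>_tilde_def gravity_def kappa_tilde_def m_tilde_def p_tilde_def)
  qed (use r cont in \<open>auto simp: \<rho>_tilde_def p_tilde_def[abs_def]\<close>)
qed

lemma C1_\<rho>_tilde: "\<rho>_tilde C1_differentiable_on {0<..<rE}"
proof (rule C1_differentiable_onI)
  define q where "q = (\<lambda>s. (s + P s / c\<^sup>2) / deriv P s)"
  \<comment> \<open>This limit matches the coefficient of the interior slope with the exterior slope
    0 of the continued density.\<close>
  have "((\<lambda>r. q (\<rho> r)) \<longlongrightarrow> 0) (at_left rp)"
    using filterlim_compose[OF tendsto_enthalpy_density_ratio \<rho>_lim] by (simp add: q_def)
  moreover have "isCont (\<lambda>r. q (\<rho> r)) r" if r: "0 < r" "r < rp" for r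
  proof -
    have "continuous_on {0<..} q" unfolding q_def
      by (intro continuous_intros continuous_on_P continuous_on_deriv_P)
        (use c_pos deriv_P_pos in fastforce)+
    then have "isCont q (\<rho> r)" using \<rho>_pos[OF r] by (simp add: continuous_on_eq_continuous_at)
    then show ?thesis using DERIV_isCont[OF DERIV_\<rho>[OF r]] by (rule isCont_o2[rotated])
  qed
  ultimately have q: "continuous_on {0<..<rE} (\<lambda>r. if r < rp then q (\<rho> r) else 0)"
    by (intro continuous_on_extension) auto
  show cont: "continuous_on {0<..<rE} (\<lambda>r. - ((if r < rp then q (\<rho> r) else 0) * gravity r))"
    by (intro continuous_intros q continuous_on_gravity)
  fix r assume r: "r \<in> {0<..<rE}"
  show "(\<rho>_tilde has_real_derivative - ((if r < rp then q (\<rho> r) else 0) * gravity r)) (at r)"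
    unfolding \<rho>_tilde_def[abs_def]
  proof (rule DERIV_extension)
    show "continuous_on {0<..<rE} (\<lambda>r. if r < rp then \<rho> r else 0)"
      using continuous_on_\<rho>_tilde by (simp add: \<rho>_tilde_def[abs_def])
    show "(\<rho> has_real_derivative - ((if x < rp then q (\<rho> x) else 0) * gravity x)) (at x)"
      if "0 < x" "x < rp" for x
      using DERIV_\<rho>[OF that] that
      by (simp add: q_def gravity_def kappa_tilde_def m_tilde_def p_tilde_def)
  qed (use r cont in auto)
qed

lemma C1_m_tilde: "m_tilde rp m C1_differentiable_on {0<..<rE}"
  by (rule C1_differentiable_onI, erule DERIV_m_tilde)
    (intro continuous_intros continuous_on_\<rho>_tilde)

lemma C1_inverse_r: "(\<lambda>r. inverse r) C1_differentiable_on {0<..<rE}"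
  by (rule C1_differentiable_on_inverse) auto

lemma C1_kappa_tilde: "kappa_tilde C1_differentiable_on {0<..<rE}"
proof -
  \<comment> \<open>Division by \<open>r\<close> becomes a product with \<open>inverse r\<close>, so
    that the closure rules for products apply.\<close>
  have eq: "kappa_tilde = (\<lambda>r. 1 - 2 * G / c\<^sup>2 * (m_tilde rp m r * inverse r) - \<Lambda> / 3 * r ^ 2)"
    by (simp add: kappa_tilde_def kappa_def fun_eq_iff field_simps)
  show ?thesis unfolding eq
    by (intro C1_differentiable_on_diff C1_differentiable_on_mult C1_differentiable_on_const
        C1_differentiable_on_power C1_differentiable_on_ident C1_m_tilde C1_inverse_r)
qed

lemma C1_gravity: "gravity C1_differentiable_on {0<..<rE}"
proof -
  let ?Q = "\<lambda>r. Q_fun c G \<Lambda> r (m_tilde rp m r) (p_tilde r)"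
  have "?Q = (\<lambda>r. G * (m_tilde rp m r + 4 * pi / c\<^sup>2 * r ^ 3 * p_tilde r) - c\<^sup>2 * \<Lambda> / 3 * r ^ 3)"
    by (simp add: Q_fun_def fun_eq_iff mult_ac)
  then have Q: "?Q C1_differentiable_on {0<..<rE}"
    by (simp only:) (intro C1_differentiable_on_diff C1_differentiable_on_add
        C1_differentiable_on_mult C1_differentiable_on_const C1_differentiable_on_power
        C1_differentiable_on_ident C1_m_tilde C1_p_tilde)
  have eq: "gravity = (\<lambda>r. ?Q r * (inverse r ^ 2 * inverse (kappa_tilde r)))"
    by (simp add: gravity_def fun_eq_iff divide_inverse power_inverse)
  have "(\<lambda>r. inverse (kappa_tilde r)) C1_differentiable_on {0<..<rE}"
    by (rule C1_differentiable_on_inverse[OF C1_kappa_tilde]) (use kappa_tilde_pos in fastforce)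
  then show ?thesis unfolding eq
    by (intro Q C1_differentiable_on_mult C1_differentiable_on_power C1_inverse_r)
qed

section \<open>Twice continuous differentiability of the metric coefficients\<close>

lemma u_sol_lim: "(u_sol c P p \<longlongrightarrow> 0) (at_left rp)"
  using filterlim_compose[OF tendsto_u_of_density \<rho>_lim]
  by (simp add: u_sol_def[abs_def] \<rho>_def)

lemma C2_g00: "C2_differentiable_on (g00 c G \<Lambda> P rp m p) {0<..<rE}"
proof -
  let ?e = "\<lambda>r. kappa_plus c G \<Lambda> rp m * exp (- 2 * u_sol c P p r / c\<^sup>2)"
  let ?k = "\<lambda>r. 1 - 2 * G * M / (c\<^sup>2 * r) - \<Lambda> / 3 * r\<^sup>2"
  let ?g = "g00 c G \<Lambda> P rp m p"
  have g: "?g = (\<lambda>r. if r < rp then ?e r else ?k r)" by (simp add: g00_def fun_eq_iff)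
  have De: "(?e has_real_derivative ?e r * (2 / c\<^sup>2 * gravity r)) (at r)" if r: "0 < r" "r < rp" for r
  proof -
    have "(u_sol c P p has_real_derivative - gravity r) (at r)"
      using DERIV_u_sol[OF r] r by (simp add: gravity_def kappa_tilde_def m_tilde_def p_tilde_def)
    then show ?thesis
      using c_pos by (auto intro!: derivative_eq_intros simp: power2_eq_square)
  qed
  have Dk: "(?k has_real_derivative ?k r * (2 / c\<^sup>2 * gravity r)) (at r)" if r: "rp < r" "r < rE" for r
  proof -
    have "0 < r" using r rp_pos by simp
    have k: "?k r = kappa_tilde r" using r by (simp add: kappa_tilde_def kappa_def m_tilde_def)
    have k_pos: "0 < kappa_tilde r" using \<open>0 < r\<close> r by (simp add: kappa_tilde_pos)
    \<comment> \<open>The factor \<open>kappa_tilde r\<close> cancels the one in the denominator of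
      \<open>gravity\<close>, leaving \<open>Q_fun\<close> at pressure 0.\<close>
    have "kappa_tilde r * (2 / c\<^sup>2 * gravity r) = 2 / c\<^sup>2 * ((G * M - c\<^sup>2 * \<Lambda> / 3 * r ^ 3) / r\<^sup>2)"
      using k_pos r by (simp add: gravity_def Q_fun_def p_tilde_def m_tilde_def)
    also have "\<dots> = 2 * G * M / (c\<^sup>2 * r\<^sup>2) - 2 * \<Lambda> / 3 * r"
      using \<open>0 < r\<close> c_pos by (simp add: field_simps power2_eq_square power3_eq_cube)
    finally have "?k r * (2 / c\<^sup>2 * gravity r) = 2 * G * M / (c\<^sup>2 * r\<^sup>2) - 2 * \<Lambda> / 3 * r"
      unfolding k .
    moreover have "(?k has_real_derivative 2 * G * M / (c\<^sup>2 * r\<^sup>2) - 2 * \<Lambda> / 3 * r) (at r)"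
      using \<open>0 < r\<close> c_pos
      by (auto intro!: derivative_eq_intros simp: field_simps power2_eq_square)
    ultimately show ?thesis by (simp only:)
  qed
  have cont: "continuous_on {0<..<rE} ?g"
    unfolding g
  proof (rule continuous_on_extension)
    show "continuous_on {rp..<rE} ?k"
      by (intro continuous_intros) (use rp_pos c_pos in auto)
    \<comment> \<open>Because \<open>u_sol\<close> vanishes at the surface, the normalization by
      \<open>kappa_plus\<close> is what makes the two branches agree there.\<close>
    have "(?e \<longlongrightarrow> kappa_plus c G \<Lambda> rp m * exp (- 2 * 0 / c\<^sup>2)) (at_left rp)"
      by (intro tendsto_intros u_sol_lim) (use c_pos in auto)
    then show "(?e \<longlongrightarrow> ?k rp) (at_left rp)" by (simp add: kappa_plus_eq kappa_def)
  qed (rule DERIV_isCont[OF De])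
  have Dg: "(?g has_real_derivative ?g r * (2 / c\<^sup>2 * gravity r)) (at r)" if "r \<in> {0<..<rE}" for r
  proof -
    have "((\<lambda>r. if r < rp then ?e r else ?k r) has_real_derivative ?g r * (2 / c\<^sup>2 * gravity r)) (at r)"
    proof (rule DERIV_extension[OF _ _ _ _ that])
      show "continuous_on {0<..<rE} (\<lambda>r. if r < rp then ?e r else ?k r)"
        using cont unfolding g .
      show "continuous_on {0<..<rE} (\<lambda>r. ?g r * (2 / c\<^sup>2 * gravity r))"
        by (intro continuous_intros cont continuous_on_gravity) (use c_pos in auto)
      show "(?e has_real_derivative ?g x * (2 / c\<^sup>2 * gravity x)) (at x)" if "0 < x" "x < rp" for x
        using De[OF that] that by (simp only: g if_True)
      show "(?k has_real_derivative ?g x * (2 / c\<^sup>2 * gravity x)) (at x)" if "rp < x" "x < rE" for x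
        using Dk[OF that] less_not_sym[OF that(1)] by (simp only: g if_False)
    qed
    then show ?thesis unfolding g .
  qed
  \<comment> \<open>Bootstrapping in the linear equation: continuity of \<open>?g\<close> makes its
    derivative continuous, and then that derivative is a product of two C1 functions.\<close>
  have "?g C1_differentiable_on {0<..<rE}"
    by (rule C1_differentiable_onI, erule Dg, intro continuous_intros cont continuous_on_gravity)
      (use c_pos in auto)
  then have "(\<lambda>r. ?g r * (2 / c\<^sup>2 * gravity r)) C1_differentiable_on {0<..<rE}"
    by (intro C1_differentiable_on_mult C1_differentiable_on_const C1_gravity)
  then show ?thesis unfolding C2_differentiable_on_def using Dg by (intro exI conjI ballI)
qed

text \<open>The derivative of the coefficient is the slope of \<open>kappa_tilde\<close> divided by
  its square. That slope contains the slope of the mass and hence the density, so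
  \<open>C1_\<rho>_tilde\<close> is what controls the second derivative.\<close>

lemma C2_g11: "C2_differentiable_on (g11 c G \<Lambda> rp m) {0<..<rE}"
proof -
  have g: "g11 c G \<Lambda> rp m = (\<lambda>r. - inverse (kappa_tilde r))"
    by (simp add: g11_def kappa_tilde_def kappa_def fun_eq_iff)
  \<comment> \<open>\<open>D\<close> results from differentiating \<open>kappa\<close> along
    \<open>m_tilde\<close> and inserting the mass equation; one power of \<open>r\<close> cancels in
    the density term.\<close>
  define D where "D = (\<lambda>r. - (2 * G / c\<^sup>2) * (4 * pi * r * \<rho>_tilde r - m_tilde rp m r * inverse r ^ 2) - 2 * \<Lambda> / 3 * r)"
  have Dk: "(kappa_tilde has_real_derivative D r) (at r)" if "r \<in> {0<..<rE}" for r
    unfolding kappa_tilde_def[abs_def] kappa_def D_def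
    using that c_pos
    by (auto intro!: derivative_eq_intros DERIV_m_tilde simp: field_simps power2_eq_square)
  have D: "D C1_differentiable_on {0<..<rE}"
    unfolding D_def
    by (intro C1_differentiable_on_diff C1_differentiable_on_mult C1_differentiable_on_const
        C1_differentiable_on_power C1_differentiable_on_ident C1_m_tilde C1_\<rho>_tilde C1_inverse_r)
  have nz: "kappa_tilde r \<noteq> 0" if "r \<in> {0<..<rE}" for r
    using kappa_tilde_pos[OF that] by simp
  have "((\<lambda>r. - inverse (kappa_tilde r)) has_real_derivative D r * inverse (kappa_tilde r) ^ 2) (at r)"
    if "r \<in> {0<..<rE}" for r
    using Dk[OF that] nz[OF that]
    by (auto intro!: derivative_eq_intros simp: power2_eq_square mult_ac)
  moreover have "(\<lambda>r. D r * inverse (kappa_tilde r) ^ 2) C1_differentiable_on {0<..<rE}"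
    by (intro C1_differentiable_on_mult C1_differentiable_on_power D
        C1_differentiable_on_inverse C1_kappa_tilde nz)
  ultimately show ?thesis unfolding g C2_differentiable_on_def by (intro exI conjI ballI)
qed

end

end

theorem theorem3:
  fixes c G \<Lambda> A \<gamma> rp :: real and \<Omega> P m p :: "real \<Rightarrow> real"
  assumes "0 < c" and "0 < G" and "0 < \<Lambda>"
    and "pressure_law c A \<gamma> \<Omega> P"
    and "monotone_short c G \<Lambda> P rp m p"
  shows "\<exists>rI rE. horizons c G \<Lambda> rp (m_plus rp m) rI rE \<and>
    (\<forall>r\<in>{0<..<rp}. spherical_metric c (g00 c G \<Lambda> P rp m p r) (g11 c G \<Lambda> rp m r) r =
       interior_metric c G \<Lambda> P rp m p r) \<and>
    (\<forall>r\<in>{rp..<rE}. spherical_metric c (g00 c G \<Lambda> P rp m p r) (g11 c G \<Lambda> rp m r) r =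
       exterior_metric c G \<Lambda> (m_plus rp m) r) \<and>
    C2_differentiable_on (g00 c G \<Lambda> P rp m p) {0<..<rE} \<and>
    C2_differentiable_on (g11 c G \<Lambda> rp m) {0<..<rE}"
proof -
  interpret tov_star c A \<gamma> \<Omega> P G \<Lambda> rp m p
    using assms by unfold_locales
  obtain rI rE where hor: "horizons c G \<Lambda> rp M rI rE"
    using horizons_M by blast
  then show ?thesis
    using C2_g00[OF hor] C2_g11[OF hor]
    by (intro exI[of _ rI] exI[of _ rE] conjI ballI patched_metric) simp_all
qed

end
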